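(* Let $n,p\in\mathbb N$. Every element of $\left(C(S^1)^{(n)}\otimes_{\rm min}\mathcal M_p(\mathbb C)\right)_+$ is separable. That is, a matrix $T\in C(S^1)^{(n)}\otimes_{\rm min}\mathcal M_p(\mathbb C)$ (an $n\times n$ Toeplitz matrix with entries in $\mathcal M_p(\mathbb C)$) is positive if and only if there are $\lambda_1,\dots,\lambda_m\in S^1$ and positive $b_1,\dots,b_m\in\mathcal M_p(\mathbb C)$ such that $$T=\sum_{j=1}^m T_n(\lambda_j)\otimes b_j.$$
   Context: $S^1\subset\mathbb C$ is the unit circle and $\mathcal M_p(\mathbb C)$ is the C$^*$-algebra of $p\times p$ complex matrices; "positive" for matrices means positive semidefinite. $C(S^1)^{(n)}$ is the operator system of all $n\times n$ complex Toeplitz matrices, a subsystem of $\mathcal M_n(\mathbb C)$ with the identity matrix as order unit. Its canonical basis is $\{r_\ell\}_{\ell=-n+1}^{n-1}$, where $r_\ell$ has $(k,j)$-entry $1$ if $k-j=\ell$ and $0$ otherwise. Elements $\sum_{\ell} r_\ell\otimes\tau_\ell$ of $C(S^1)^{(n)}\otimes_{\rm min}\mathcal M_p(\mathbb C)$ are identified with the block Toeplitz matrices $[\tau_{k-j}]_{k,j=1}^n$, $\tau_\ell\in\mathcal M_p(\mathbb C)$, and are positive iff they are positive semidefinite as elements of $\mathcal M_n(\mathbb C)\otimes\mathcal M_p(\mathbb C)$ (here $\otimes_{\rm min}$ is the spatial operator system tensor product). A positive element $x$ of $\mathcal R\otimes_{\rm min}\mathcal S$ ($\mathcal R,\mathcal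 S$ operator systems) is separable if $x=\sum_{j=1}^m r_j\otimes s_j$ for some positive $r_j\in\mathcal R$ and positive $s_j\in\mathcal S$. For $z\in S^1$, $T_n(z)=[z^{k-j}]_{k,j=1}^n\in C(S^1)^{(n)}$. *)

theory Defs
  imports "Jordan_Normal_Form.Schur_Decomposition"
begin

section \<open>Positivity, sums and tensor products of complex matrices\<close>

text \<open>
  The order on the complex numbers is the one of \<^theory>\<open>HOL-Library.Complex_Order\<close>: \<open>0 \<le> z\<close> says
  that \<open>z\<close> is real and nonnegative. So a positive semidefinite matrix is automatically Hermitian.
\<close>

definition psd :: "nat \<Rightarrow> complex mat \<Rightarrow> bool" where
  "psd d A \<longleftrightarrow> A \<in> carrier_mat d d \<and> (\<forall>v \<in> carrier_vec d. 0 \<le> (A *\<^sub>v v) \<bullet>c v)"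

abbreviation msum :: "nat \<Rightarrow> ('i \<Rightarrow> complex mat) \<Rightarrow> 'i set \<Rightarrow> complex mat" where
  "msum d \<equiv> finsum (module_mat TYPE(complex) d d)"

text \<open>
  The identification of \<open>M\<^sub>n \<otimes> M\<^sub>p\<close> with \<open>np \<times> np\<close> matrices: \<open>A \<otimes> B\<close> is the block matrix whose
  \<open>(k, j)\<close> block is \<open>A $$ (k, j)\<close> times \<open>B\<close>.
\<close>

definition kron :: "complex mat \<Rightarrow> complex mat \<Rightarrow> complex mat" (infixl "\<otimes>\<^sub>m" 70) where
  "A \<otimes>\<^sub>m B = mat (dim_row A * dim_row B) (dim_col A * dim_col B)
     (\<lambda>(i, j). A $$ (i div dim_row B, j div dim_col B) * B $$ (i mod dim_row B, j mod dim_col B))"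


section \<open>Operator subsystems of matrix algebras\<close>

text \<open>
  An operator system is given by a concrete unital selfadjoint subspace of \<open>M\<^sub>d\<close>. Its order
  unit is the identity matrix and its positive elements are those that are positive semidefinite.
  The cones at higher matrix levels are inherited from \<open>M\<^sub>d\<close> as well; separability only involves the
  ground-level cones, so they are not named.
\<close>

definition operator_system :: "nat \<Rightarrow> complex mat set \<Rightarrow> bool" where
  "operator_system d R \<longleftrightarrow>
     R \<subseteq> carrier_mat d d \<and> 1\<^sub>m d \<in> R \<and>
     (\<forall>A \<in> R. \<forall>B \<in> R. A + B \<in> R) \<and> (\<forall>c. \<forall>A \<in> R. c \<cdot>\<^sub>m A \<in> R) \<and>
     (\<forall>A \<in> R. mat_adjoint A \<in> R)"

definition pos_cone :: "nat \<Rightarrow> complex mat set \<Rightarrow> complex mat set" where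
  "pos_cone d R = {A \<in> R. psd d A}"

text \<open>
  For operator systems \<open>R \<subseteq> M\<^sub>n\<close> and \<open>S \<subseteq> M\<^sub>p\<close>, the spatial tensor product is the algebraic tensor
  product, i.e. the sums of elementary tensors, as an operator subsystem of \<open>M\<^sub>n \<otimes> M\<^sub>p\<close>.
\<close>

definition min_tensor ::
    "nat \<Rightarrow> nat \<Rightarrow> complex mat set \<Rightarrow> complex mat set \<Rightarrow> complex mat set" where
  "min_tensor n p R S =
     {x. \<exists>(m::nat) r s. (\<forall>j<m. r j \<in> R \<and> s j \<in> S) \<and> x = msum (n * p) (\<lambda>j. r j \<otimes>\<^sub>m s j) {..<m}}"

definition separable ::
    "nat \<Rightarrow> nat \<Rightarrow> complex mat set \<Rightarrow> complex mat set \<Rightarrow> complex mat \<Rightarrow> bool" where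
  "separable n p R S x \<longleftrightarrow>
     (\<exists>(m::nat) r s. (\<forall>j<m. r j \<in> pos_cone n R \<and> s j \<in> pos_cone p S) \<and>
        x = msum (n * p) (\<lambda>j. r j \<otimes>\<^sub>m s j) {..<m})"


section \<open>Toeplitz matrices\<close>

text \<open>Matrix indices start at 0, which does not affect the differences \<open>k - j\<close>.\<close>

definition toeplitz_system :: "nat \<Rightarrow> complex mat set" where
  "toeplitz_system n = {mat n n (\<lambda>(k, j). a (int k - int j)) | a :: int \<Rightarrow> complex. True}"

definition toeplitz_basis :: "nat \<Rightarrow> int \<Rightarrow> complex mat" where
  "toeplitz_basis n l = mat n n (\<lambda>(k, j). if int k - int j = l then 1 else 0)"

definition block_toeplitz :: "nat \<Rightarrow> nat \<Rightarrow> (int \<Rightarrow> complex mat) \<Rightarrow> complex mat" where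
  "block_toeplitz n p \<tau> =
     mat (n * p) (n * p) (\<lambda>(i, j). \<tau> (int (i div p) - int (j div p)) $$ (i mod p, j mod p))"

definition toeplitz_pt :: "nat \<Rightarrow> complex \<Rightarrow> complex mat" where
  "toeplitz_pt n z = mat n n (\<lambda>(k, j). z powi (int k - int j))"


section \<open>Consistency of the conventions\<close>

lemma kron_carrier [simp]:
  assumes "A \<in> carrier_mat n n" "B \<in> carrier_mat p p"
  shows "A \<otimes>\<^sub>m B \<in> carrier_mat (n * p) (n * p)"
  using assms by (auto simp: kron_def)

lemma kron_index:
  assumes "A \<in> carrier_mat n n" "B \<in> carrier_mat p p" "i < n * p" "j < n * p"
  shows "(A \<otimes>\<^sub>m B) $$ (i, j) = A $$ (i div p, j div p) * B $$ (i mod p, j mod p)"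
  using assms by (auto simp: kron_def)

lemma msum_carrier_index:
  assumes "finite I" and "\<And>i. i \<in> I \<Longrightarrow> f i \<in> carrier_mat d d"
  shows "msum d f I \<in> carrier_mat d d \<and>
    (\<forall>a<d. \<forall>b<d. msum d f I $$ (a, b) = (\<Sum>i\<in>I. f i $$ (a, b)))"
  using assms
proof (induction I rule: finite_induct)
  case empty
  have "msum d f {} = 0\<^sub>m d d"
    using abelian_monoid.finsum_empty[OF abelian_group.axioms(1)[OF abelian_group_mat]]
    by (metis module_mat_simps(4))
  then show ?case by simp
next
  case (insert x F)
  have fx: "f x \<in> carrier_mat d d" and fF: "f \<in> F \<rightarrow> carrier_mat d d"
    using insert.prems by blast+
  have eq: "msum d f (insert x F) = f x + msum d f F"
    using abelian_monoid.finsum_insert[OF abelian_group.axioms(1)[OF abelian_group_mat],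
        OF insert.hyps, of f, unfolded module_mat_simps, OF fF fx] .
  have IH: "msum d f F \<in> carrier_mat d d \<and>
    (\<forall>a<d. \<forall>b<d. msum d f F $$ (a, b) = (\<Sum>i\<in>F. f i $$ (a, b)))"
    by (rule insert.IH) (rule insert.prems, rule insertI2)
  note dims = carrier_matD[OF conjunct1[OF IH]]
  show ?case unfolding eq using IH fx insert.hyps by (simp add: dims)
qed

lemmas msum_carrier = conjunct1[OF msum_carrier_index]
lemmas msum_index = conjunct2[OF msum_carrier_index, rule_format]

lemma toeplitz_operator_system: "operator_system n (toeplitz_system n)"
proof -
  have "1\<^sub>m n \<in> toeplitz_system n"
    unfolding toeplitz_system_def
    by (rule CollectI, rule exI[of _ "\<lambda>l. if l = 0 then 1 else 0"]) (auto intro!: eq_matI)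
  moreover have "A + B \<in> toeplitz_system n"
    if "A \<in> toeplitz_system n" "B \<in> toeplitz_system n" for A B
  proof -
    from that obtain a b where "A = mat n n (\<lambda>(k, j). a (int k - int j))"
      "B = mat n n (\<lambda>(k, j). b (int k - int j))" by (auto simp: toeplitz_system_def)
    then show ?thesis unfolding toeplitz_system_def
      by (intro CollectI exI[of _ "\<lambda>l. a l + b l"]) (auto intro!: eq_matI)
  qed
  moreover have "c \<cdot>\<^sub>m A \<in> toeplitz_system n" if "A \<in> toeplitz_system n" for A c
  proof -
    from that obtain a where "A = mat n n (\<lambda>(k, j). a (int k - int j))"
      by (auto simp: toeplitz_system_def)
    then show ?thesis unfolding toeplitz_system_def
      by (intro CollectI exI[of _ "\<lambda>l. c * a l"]) (auto intro!: eq_matI)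
  qed
  moreover have "mat_adjoint A \<in> toeplitz_system n" if "A \<in> toeplitz_system n" for A
  proof -
    from that obtain a where "A = mat n n (\<lambda>(k, j). a (int k - int j))"
      by (auto simp: toeplitz_system_def)
    then show ?thesis unfolding toeplitz_system_def
      by (intro CollectI exI[of _ "\<lambda>l. cnj (a (- l))"])
        (auto intro!: eq_matI simp: mat_adjoint_def mat_of_rows_def)
  qed
  moreover have "toeplitz_system n \<subseteq> carrier_mat n n"
    unfolding toeplitz_system_def by auto
  ultimately show ?thesis unfolding operator_system_def by blast
qed

lemma msum_basis_eq_block:
  assumes \<tau>: "\<And>l. \<tau> l \<in> carrier_mat p p"
  shows "msum (n * p) (\<lambda>l. toeplitz_basis n l \<otimes>\<^sub>m \<tau> l) {- int n + 1..int n - 1}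
    = block_toeplitz n p \<tau>" (is "msum _ ?f ?I = _")
proof (rule eq_matI)
  have c: "?f l \<in> carrier_mat (n * p) (n * p)" for l
    by (rule kron_carrier) (auto simp: toeplitz_basis_def \<tau>)
  note dims = carrier_matD[OF msum_carrier[of ?I ?f "n * p", OF finite_atLeastAtMost_int c]]
  show "dim_row (msum (n * p) ?f ?I) = dim_row (block_toeplitz n p \<tau>)"
    "dim_col (msum (n * p) ?f ?I) = dim_col (block_toeplitz n p \<tau>)"
    unfolding dims block_toeplitz_def dim_row_mat dim_col_mat by (rule refl)+
  fix i j assume "i < dim_row (block_toeplitz n p \<tau>)" "j < dim_col (block_toeplitz n p \<tau>)"
  then have ij: "i < n * p" "j < n * p" by (auto simp: block_toeplitz_def)
  then have d: "i div p < n" "j div p < n" by (auto simp: less_mult_imp_div_less)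
  let ?d = "int (i div p) - int (j div p)"
  have "msum (n * p) ?f ?I $$ (i, j) = (\<Sum>l\<in>?I. ?f l $$ (i, j))"
    by (rule msum_index[OF finite_atLeastAtMost_int c ij])
  also have "\<dots> = (\<Sum>l\<in>?I. if ?d = l then \<tau> l $$ (i mod p, j mod p) else 0)"
  proof (rule sum.cong[OF refl])
    fix l
    have "?f l $$ (i, j)
      = toeplitz_basis n l $$ (i div p, j div p) * \<tau> l $$ (i mod p, j mod p)"
      by (rule kron_index[OF _ \<tau> ij]) (simp add: toeplitz_basis_def)
    then show "?f l $$ (i, j) = (if ?d = l then \<tau> l $$ (i mod p, j mod p) else 0)"
      using d by (simp add: toeplitz_basis_def)
  qed
  also have "\<dots> = \<tau> ?d $$ (i mod p, j mod p)"
    using d by (subst sum.delta') auto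
  finally show "msum (n * p) ?f ?I $$ (i, j) = block_toeplitz n p \<tau> $$ (i, j)"
    using ij by (simp add: block_toeplitz_def)
qed

lemma min_tensor_toeplitz_iff_block:
  "T \<in> min_tensor n p (toeplitz_system n) (carrier_mat p p) \<longleftrightarrow>
     (\<exists>\<tau>. (\<forall>l. \<tau> l \<in> carrier_mat p p) \<and> T = block_toeplitz n p \<tau>)"
proof
  assume "T \<in> min_tensor n p (toeplitz_system n) (carrier_mat p p)"
  then obtain m :: nat and r s where rs: "\<And>j. j < m \<Longrightarrow> r j \<in> toeplitz_system n"
    "\<And>j. j < m \<Longrightarrow> s j \<in> carrier_mat p p"
    and T: "T = msum (n * p) (\<lambda>j. r j \<otimes>\<^sub>m s j) {..<m}" by (auto simp: min_tensor_def)
  have "\<forall>j. \<exists>a. j < m \<longrightarrow> r j = mat n n (\<lambda>(k, i). a (int k - int i))"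
    using rs(1) by (auto simp: toeplitz_system_def)
  then obtain a where a: "\<And>j. j < m \<Longrightarrow> r j = mat n n (\<lambda>(k, i). a j (int k - int i))" by metis
  have rc: "r j \<in> carrier_mat n n" if "j < m" for j using a[OF that] by auto
  define \<tau> where "\<tau> l = mat p p (\<lambda>ab. \<Sum>j<m. a j l * s j $$ ab)" for l
  have c: "r j \<otimes>\<^sub>m s j \<in> carrier_mat (n * p) (n * p)" if "j \<in> {..<m}" for j
    using kron_carrier[OF rc rs(2)] that by auto
  have "T \<in> carrier_mat (n * p) (n * p)"
    unfolding T by (rule msum_carrier[OF finite_lessThan c])
  note dims = carrier_matD[OF this]
  have "T = block_toeplitz n p \<tau>"
  proof (rule eq_matI)
    show "dim_row T = dim_row (block_toeplitz n p \<tau>)" "dim_col T = dim_col (block_toeplitz n p \<tau>)"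
      unfolding dims block_toeplitz_def dim_row_mat dim_col_mat by (rule refl)+
    fix i j assume "i < dim_row (block_toeplitz n p \<tau>)" "j < dim_col (block_toeplitz n p \<tau>)"
    then have ij: "i < n * p" "j < n * p" by (auto simp: block_toeplitz_def)
    then have d: "i div p < n" "j div p < n" and p: "p > 0"
      by (auto simp: less_mult_imp_div_less intro: gr0I)
    have "T $$ (i, j) = (\<Sum>k<m. (r k \<otimes>\<^sub>m s k) $$ (i, j))"
      unfolding T by (rule msum_index[OF finite_lessThan c ij])
    also have "\<dots> = (\<Sum>k<m. a k (int (i div p) - int (j div p)) * s k $$ (i mod p, j mod p))"
    proof (rule sum.cong[OF refl])
      fix k assume "k \<in> {..<m}"
      then have k: "k < m" by simp
      show "(r k \<otimes>\<^sub>m s k) $$ (i, j)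
        = a k (int (i div p) - int (j div p)) * s k $$ (i mod p, j mod p)"
        unfolding kron_index[OF rc[OF k] rs(2)[OF k] ij] using d by (simp add: a[OF k])
    qed
    finally show "T $$ (i, j) = block_toeplitz n p \<tau> $$ (i, j)"
      using ij p by (simp add: block_toeplitz_def \<tau>_def)
  qed
  then show "\<exists>\<tau>. (\<forall>l. \<tau> l \<in> carrier_mat p p) \<and> T = block_toeplitz n p \<tau>"
    by (intro exI[of _ \<tau>]) (auto simp: \<tau>_def)
next
  assume "\<exists>\<tau>. (\<forall>l. \<tau> l \<in> carrier_mat p p) \<and> T = block_toeplitz n p \<tau>"
  then obtain \<tau> where \<tau>: "\<And>l. \<tau> l \<in> carrier_mat p p" and T: "T = block_toeplitz n p \<tau>" by auto
  let ?I = "{- int n + 1..int n - 1}" and ?m = "card {- int n + 1..int n - 1}"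
  let ?M = "module_mat TYPE(complex) (n * p) (n * p)"
  let ?f = "\<lambda>l. toeplitz_basis n l \<otimes>\<^sub>m \<tau> l"
  interpret abelian_group ?M by (rule abelian_group_mat)
  have b: "toeplitz_basis n l \<in> toeplitz_system n" for l
    unfolding toeplitz_system_def toeplitz_basis_def
    by (rule CollectI, rule exI[of _ "\<lambda>k. if k = l then 1 else 0"]) auto
  obtain h where h: "bij_betw h {..<?m} ?I"
    using ex_bij_betw_nat_finite[of ?I] by (auto simp: atLeast0LessThan)
  have c: "?f l \<in> carrier_mat (n * p) (n * p)" for l
    by (rule kron_carrier) (auto simp: toeplitz_basis_def \<tau>)
  have "T = msum (n * p) ?f (h ` {..<?m})"
    using msum_basis_eq_block[OF \<tau>, of n] h T by (simp add: bij_betw_def)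
  also have "\<dots> = msum (n * p) (\<lambda>j. ?f (h j)) {..<?m}"
    using h c by (intro finsum_reindex) (auto simp: bij_betw_def module_mat_simps)
  finally show "T \<in> min_tensor n p (toeplitz_system n) (carrier_mat p p)"
    unfolding min_tensor_def using b \<tau>
    by (intro CollectI exI[of _ ?m] exI[of _ "\<lambda>j. toeplitz_basis n (h j)"] exI[of _ "\<lambda>j. \<tau> (h j)"])
      auto
qed

end

theory Submission
  imports Defs "Jordan_Normal_Form.Spectral_Radius"
begin

text \<open>Write a positive block Toeplitz matrix T as the Gram matrix of vectors
  \<open>y i\<close> with \<open>i < n * p\<close>, grouped into n blocks of p vectors. The blocks
  of T depend only on the difference of the block indices, so the first n-1 blocks of vectors have
  the same Gram matrix as the last n-1. Hence a unitary U sends each \<open>y i\<close> to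
  \<open>y (i + p)\<close> (\<open>unitary_extension\<close>).

  Diagonalize U; its eigenvalues \<mu>_l lie on the circle. In the eigenbasis, the l-th coordinate
  of the a-th vector of block k is \<mu>_l^k times that of the a-th vector of block 0. Expanding the
  inner products in these coordinates turns block (k, j) of T into the sum over l of z_l^(k-j) b_l,
  where z_l is the conjugate of \<mu>_l and b_l is the positive matrix of rank at most one formed
  from the l-th coordinates of block 0. This is the decomposition sought, with np terms
  (\<open>psd_block_toeplitz_decomposition\<close>).

  Conversely, for |z| = 1 the matrix T_n(z) is a positive matrix of rank at most one, and T_n(z)
  \<otimes> B is a congruence transform of B, hence positive (\<open>psd_toeplitz_pt_kron\<close>);
  sums preserve positivity.

  The finite-dimensional spectral theorem \<open>spectral_theorem_normal\<close> enters twice: it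
  produces the Gram vectors (\<open>psd_imp_gram\<close>) and diagonalizes U
  (\<open>unitary_diagonalization\<close>).\<close>

section \<open>Adjoints and the inner product in coordinates\<close>

lemma mat_adjoint_carrier [simp]:
  "A \<in> carrier_mat n m \<Longrightarrow> mat_adjoint A \<in> carrier_mat m n"
  by (auto simp: mat_adjoint_def mat_of_rows_def)

lemma mat_adjoint_index [simp]:
  assumes "A \<in> carrier_mat n m" "i < m" "j < n"
  shows "mat_adjoint A $$ (i, j) = conjugate (A $$ (j, i))"
  using assms by (auto simp: mat_adjoint_def mat_of_rows_def)

lemma mult_mat_index:
  assumes "A \<in> carrier_mat n m" "B \<in> carrier_mat m k" "i < n" "j < k"
  shows "(A * B) $$ (i, j) = (\<Sum>l = 0..<m. A $$ (i, l) * B $$ (l, j))"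
  using assms by (auto simp: scalar_prod_def intro!: sum.cong)

lemma mult_mat_vec_index:
  assumes "A \<in> carrier_mat n m" "v \<in> carrier_vec m" "i < n"
  shows "(A *\<^sub>v v) $ i = (\<Sum>l = 0..<m. A $$ (i, l) * v $ l)"
  using assms by (auto simp: scalar_prod_def intro!: sum.cong)

lemma cscalar_prod_sum:
  assumes "w \<in> carrier_vec n"
  shows "v \<bullet>c w = (\<Sum>l = 0..<n. v $ l * conjugate (w $ l))"
  using assms by (auto simp: scalar_prod_def intro!: sum.cong)

lemma mult_mat_vec_unit_vec:
  fixes A :: "'a::comm_ring_1 mat"
  assumes "A \<in> carrier_mat n m" "i < m"
  shows "A *\<^sub>v unit_vec m i = col A i"
  using assms by (intro eq_vecI) auto

lemma mat_adjoint_cscalar_prod: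
  fixes A :: "complex mat"
  assumes A: "A \<in> carrier_mat n m" and v: "v \<in> carrier_vec m" and w: "w \<in> carrier_vec n"
  shows "(A *\<^sub>v v) \<bullet>c w = v \<bullet>c (mat_adjoint A *\<^sub>v w)"
proof -
  have "(A *\<^sub>v v) \<bullet>c w = (\<Sum>i = 0..<n. \<Sum>l = 0..<m. A $$ (i, l) * v $ l * cnj (w $ i))"
    unfolding cscalar_prod_sum[OF w]
    by (intro sum.cong refl) (simp add: mult_mat_vec_index[OF A v] sum_distrib_right del: index_mult_mat_vec)
  also have "\<dots> = (\<Sum>l = 0..<m. \<Sum>i = 0..<n. A $$ (i, l) * v $ l * cnj (w $ i))"
    by (rule sum.swap)
  also have "\<dots> = v \<bullet>c (mat_adjoint A *\<^sub>v w)"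
    unfolding cscalar_prod_sum[OF mult_mat_vec_carrier[OF mat_adjoint_carrier[OF A] w]]
    by (intro sum.cong refl)
      (simp add: mult_mat_vec_index[OF mat_adjoint_carrier[OF A] w] mat_adjoint_index[OF A]
        sum_distrib_left mult_ac del: index_mult_mat_vec)
  finally show ?thesis .
qed

lemma mat_adjoint_adjoint: "mat_adjoint (mat_adjoint A) = (A :: complex mat)"
proof -
  have A: "A \<in> carrier_mat (dim_row A) (dim_col A)" by simp
  show ?thesis
    using carrier_matD[OF mat_adjoint_carrier[OF mat_adjoint_carrier[OF A]]]
    by (intro eq_matI) 
      (auto simp: mat_adjoint_index[OF mat_adjoint_carrier[OF A]] mat_adjoint_index[OF A])
qed

lemma mat_adjoint_mult:
  fixes A B :: "complex mat"
  assumes A: "A \<in> carrier_mat n m" and B: "B \<in> carrier_mat m k"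
  shows "mat_adjoint (A * B) = mat_adjoint B * mat_adjoint A"
proof (rule eq_matI)
  note c = mat_adjoint_carrier[OF A] mat_adjoint_carrier[OF B] mult_carrier_mat[OF A B]
  fix i j assume "i < dim_row (mat_adjoint B * mat_adjoint A)" "j < dim_col (mat_adjoint B * mat_adjoint A)"
  then have ij: "i < k" "j < n" using c by auto
  show "mat_adjoint (A * B) $$ (i, j) = (mat_adjoint B * mat_adjoint A) $$ (i, j)"
    using ij unfolding mat_adjoint_index[OF c(3) ij] mult_mat_index[OF A B ij(2,1)] mult_mat_index[OF c(2,1) ij]
    by (auto simp: mat_adjoint_index[OF A] mat_adjoint_index[OF B] mult.commute intro!: sum.cong)
qed (use mat_adjoint_carrier[OF A] mat_adjoint_carrier[OF B] mat_adjoint_carrier[OF mult_carrier_mat[OF A B]] in auto)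

lemma conjugate_unit_vec: "conjugate (unit_vec n i :: complex vec) = unit_vec n i"
  by (intro eq_vecI) (auto simp: unit_vec_def)

section \<open>Unitary matrices\<close>

definition unitary :: "nat \<Rightarrow> complex mat \<Rightarrow> bool" where
  "unitary n U \<longleftrightarrow> U \<in> carrier_mat n n \<and> mat_adjoint U * U = 1\<^sub>m n"

lemma unitary_carrier: "unitary n U \<Longrightarrow> U \<in> carrier_mat n n"
  by (simp add: unitary_def)

lemma unitary_adjoint_mult: "unitary n U \<Longrightarrow> mat_adjoint U * U = 1\<^sub>m n"
  by (simp add: unitary_def)

text \<open>A left inverse of a square matrix is also a right inverse.\<close>

lemma unitary_mult_adjoint: "unitary n U \<Longrightarrow> U * mat_adjoint U = 1\<^sub>m n"
  unfolding unitary_def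
  using mat_mult_left_right_inverse[of "mat_adjoint U" n U] mat_adjoint_carrier by blast

lemma unitary_adjoint_mult_vec:
  assumes U: "unitary n U" and v: "v \<in> carrier_vec n"
  shows "mat_adjoint U *\<^sub>v (U *\<^sub>v v) = v"
  using assoc_mult_mat_vec[OF mat_adjoint_carrier[OF unitary_carrier[OF U]] unitary_carrier[OF U] v] 
  by (simp add: unitary_adjoint_mult[OF U] v)

lemma unitary_mult_adjoint_vec:
  assumes U: "unitary n U" and v: "v \<in> carrier_vec n"
  shows "U *\<^sub>v (mat_adjoint U *\<^sub>v v) = v"
  using assoc_mult_mat_vec[OF unitary_carrier[OF U] mat_adjoint_carrier[OF unitary_carrier[OF U]] v] 
  by (simp add: unitary_mult_adjoint[OF U] v)

lemma unitary_cscalar_prod: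
  assumes U: "unitary n U" and v: "v \<in> carrier_vec n" and w: "w \<in> carrier_vec n"
  shows "(U *\<^sub>v v) \<bullet>c (U *\<^sub>v w) = v \<bullet>c w"
  using mat_adjoint_cscalar_prod[OF unitary_carrier[OF U] v, of "U *\<^sub>v w"] 
    unitary_adjoint_mult_vec[OF U w] unitary_carrier[OF U] w by auto

lemma unitary_one: "unitary n (1\<^sub>m n)"
proof -
  have "mat_adjoint (1\<^sub>m n) = (1\<^sub>m n :: complex mat)"
    by (rule eq_matI) (auto simp: mat_adjoint_def mat_of_rows_def)
  then show ?thesis by (simp add: unitary_def)
qed

lemma unitary_iff_cscalar_prod_basis:
  assumes U: "U \<in> carrier_mat n n"
  shows "unitary n U \<longleftrightarrow> (\<forall>i<n. \<forall>j<n. col U j \<bullet>c col U i = (if i = j then 1 else 0))"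
proof -
  note A = mat_adjoint_carrier[OF U]
  have "(mat_adjoint U * U) $$ (i, j) = col U j \<bullet>c col U i" if "i < n" "j < n" for i j
    using that U cscalar_prod_sum[of "col U i" n "col U j"]
    by (simp add: mult_mat_index[OF A U] mat_adjoint_index[OF U] mult.commute del: index_mult_mat)
  moreover have "mat_adjoint U * U = 1\<^sub>m n \<longleftrightarrow>
      (\<forall>i<n. \<forall>j<n. (mat_adjoint U * U) $$ (i, j) = (if i = j then 1 else 0))"
    using carrier_matD[OF A] carrier_matD[OF U] by (auto simp: mat_eq_iff simp del: index_mult_mat(1))
  ultimately show ?thesis using U unfolding unitary_def by simp
qed

lemma unitary_mult:
  assumes U: "unitary n U" and V: "unitary n V"
  shows "unitary n (U * V)"
proof -
  note c = unitary_carrier[OF U] unitary_carrier[OF V]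
  have "col (U * V) i = U *\<^sub>v col V i" if "i < n" for i
    using c that by auto
  then show ?thesis
    using c V unitary_cscalar_prod[OF U, of "col V _" "col V _"] 
    by (subst unitary_iff_cscalar_prod_basis) 
      (auto simp: unitary_iff_cscalar_prod_basis[OF c(2)])
qed

section \<open>Unitaries with prescribed values\<close>

text \<open>The complex analogue of a Householder reflection.\<close>

lemma unitary_map_vec:
  fixes x y :: "complex vec"
  assumes x: "x \<in> carrier_vec n" and y: "y \<in> carrier_vec n" and eq: "x \<bullet>c x = y \<bullet>c y"
  shows "\<exists>W. unitary n W \<and> W *\<^sub>v x = y \<and>
    (\<forall>w \<in> carrier_vec n. w \<bullet>c x = w \<bullet>c y \<longrightarrow> W *\<^sub>v w = w)"
proof -
  define u where "u = x - y"
  have u: "u \<in> carrier_vec n" using x y by (auto simp: u_def)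
  define c where "c = x \<bullet>c u"
  have ui: "u $ i = x $ i - y $ i" if "i < n" for i using that x y by (auto simp: u_def)
  have cu: "w \<bullet>c u = w \<bullet>c x - w \<bullet>c y" for w
    unfolding cscalar_prod_sum[OF u] cscalar_prod_sum[OF x] cscalar_prod_sum[OF y]
    by (simp add: ui right_diff_distrib flip: sum_subtractf)
  have yx: "y \<bullet>c x = cnj (x \<bullet>c y)"
    unfolding cscalar_prod_sum[OF x] cscalar_prod_sum[OF y] by (simp add: mult.commute)
  have xx: "cnj (x \<bullet>c x) = x \<bullet>c x"
    unfolding cscalar_prod_sum[OF x] by (simp add: mult.commute)
  have uu: "u \<bullet>c u = c + cnj c"
  proof -
    have "u \<bullet>c u = x \<bullet>c u - y \<bullet>c u"
      unfolding cscalar_prod_sum[OF u] by (simp add: ui left_diff_distrib flip: sum_subtractf)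
    then show ?thesis using yx xx eq by (simp add: c_def cu)
  qed
  \<comment> \<open>W is 1 - u u*/c. The denominator c = <x, u> makes W x = x - u = y. Since c may
    fail to be real, unitarity rests on |u|^2 = c + cnj c, which is where the equal lengths of x and
    y enter. If c = 0, then u = 0 and W is the identity.\<close>
  define W where "W = mat n n (\<lambda>(i, j). (if i = j then 1 else 0) - u $ i * cnj (u $ j) / c)"
  have W: "W \<in> carrier_mat n n" by (simp add: W_def)
  have Wv: "W *\<^sub>v w = w - (w \<bullet>c u / c) \<cdot>\<^sub>v u" if w: "w \<in> carrier_vec n" for w
  proof (rule eq_vecI)
    fix i assume "i < dim_vec (w - (w \<bullet>c u / c) \<cdot>\<^sub>v u)"
    then have i: "i < n" using u by simp
    have "(W *\<^sub>v w) $ i = (\<Sum>l = 0..<n. (if i = l then w $ l else 0) - u $ i / c * (w $ l * cnj (u $ l)))"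
      unfolding mult_mat_vec_index[OF W w i]
      using i by (intro sum.cong refl) (auto simp: W_def left_diff_distrib)
    also have "\<dots> = w $ i - (w \<bullet>c u / c) * u $ i"
      unfolding cscalar_prod_sum[OF u] sum_subtractf using i
      by (simp add: sum_distrib_left sum_divide_distrib mult_ac)
    finally show "(W *\<^sub>v w) $ i = (w - (w \<bullet>c u / c) \<cdot>\<^sub>v u) $ i" using i w u by simp
  qed (use W u in auto)
  have Wx: "W *\<^sub>v x = y"
  proof (cases "c = 0")
    case True
    then have "u = 0\<^sub>v n" using uu conjugate_square_eq_0_vec[OF u] by simp
    then have "x = y" using ui x y by (intro eq_vecI) auto
    then show ?thesis using Wv[OF x] True x u by (simp add: smult_vec_def) auto
  next
    case False
    then have "W *\<^sub>v x = x - u" using Wv[OF x] by (simp flip: c_def)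
    then show ?thesis using x y by (auto simp: u_def)
  qed
  have "unitary n W"
    unfolding unitary_iff_cscalar_prod_basis[OF W]
  proof (intro allI impI)
    fix i j assume i: "i < n" and j: "j < n"
    have "col W j \<bullet>c col W i = (\<Sum>l = 0..<n. W $$ (l, j) * cnj (W $$ (l, i)))"
      using cscalar_prod_sum[of "col W i" n "col W j"] W i j by auto
    also have "\<dots> = (\<Sum>l = 0..<n. (if l = j then if i = j then 1 else 0 else 0)
        - (if l = j then u $ i * cnj (u $ l) / cnj c else 0)
        - (if l = i then u $ l * cnj (u $ j) / c else 0)
        + u $ i * cnj (u $ j) / (c * cnj c) * (u $ l * cnj (u $ l)))"
      using i j by (intro sum.cong refl) (auto simp: W_def algebra_simps diff_divide_distrib)
    also have "\<dots> = (if i = j then 1 else 0) - u $ i * cnj (u $ j) / cnj c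
        - u $ i * cnj (u $ j) / c + u $ i * cnj (u $ j) / (c * cnj c) * (u \<bullet>c u)"
      unfolding cscalar_prod_sum[OF u] sum_subtractf sum.distrib using i j
      by (simp add: sum_distrib_left sum_divide_distrib)
    also have "\<dots> = (if i = j then 1 else 0)"
      unfolding uu by (cases "c = 0") (auto simp: field_simps)
    finally show "col W j \<bullet>c col W i = (if i = j then 1 else 0)" .
  qed
  moreover have "W *\<^sub>v w = w" if "w \<in> carrier_vec n" "w \<bullet>c x = w \<bullet>c y" for w
    using Wv[OF that(1)] that u by (auto simp: cu)
  ultimately show ?thesis using Wx by blast
qed

text \<open>Equal Gram matrices yield a unitary, built one vector at a time. If U is already right
  on the first m vectors, follow it by the reflection W taking \<open>U a_m\<close> to
  \<open>b_m\<close>. For i < m, \<open>b i\<close> has the same inner product with both of these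
  vectors, because U preserves inner products and the Gram matrices agree, so W fixes
  \<open>b i\<close>.\<close>

lemma unitary_extension:
  fixes a b :: "nat \<Rightarrow> complex vec"
  assumes "\<And>i. i < m \<Longrightarrow> a i \<in> carrier_vec n" "\<And>i. i < m \<Longrightarrow> b i \<in> carrier_vec n"
    and "\<And>i j. i < m \<Longrightarrow> j < m \<Longrightarrow> a i \<bullet>c a j = b i \<bullet>c b j"
  shows "\<exists>U. unitary n U \<and> (\<forall>i<m. U *\<^sub>v a i = b i)"
  using assms
proof (induction m)
  case 0
  then show ?case using unitary_one by blast
next
  case (Suc m)
  then obtain U where U: "unitary n U" and Ua: "\<And>i. i < m \<Longrightarrow> U *\<^sub>v a i = b i"
    by (metis less_SucI)
  have c: "U *\<^sub>v a m \<in> carrier_vec n"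
    using unitary_carrier[OF U] Suc.prems(1)[of m] by auto
  have "(U *\<^sub>v a m) \<bullet>c (U *\<^sub>v a m) = b m \<bullet>c b m"
    using unitary_cscalar_prod[OF U] Suc.prems by simp
  then obtain W where W: "unitary n W" "W *\<^sub>v (U *\<^sub>v a m) = b m"
    and fix_: "\<And>w. w \<in> carrier_vec n \<Longrightarrow> w \<bullet>c (U *\<^sub>v a m) = w \<bullet>c b m \<Longrightarrow> W *\<^sub>v w = w"
    using unitary_map_vec[OF c Suc.prems(2)[of m]] by auto
  have "(W * U) *\<^sub>v a i = b i" if i: "i < Suc m" for i
  proof -
    have "(W * U) *\<^sub>v a i = W *\<^sub>v (U *\<^sub>v a i)"
      by (rule assoc_mult_mat_vec[OF unitary_carrier[OF W(1)] unitary_carrier[OF U]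
            Suc.prems(1)[OF i]])
    also have "\<dots> = b i"
    proof (cases "i = m")
      case False
      with i have "i < m" by simp
      then have "b i \<bullet>c (U *\<^sub>v a m) = b i \<bullet>c b m"
        using unitary_cscalar_prod[OF U, of "a i" "a m"] Suc.prems Ua by simp
      then show ?thesis using fix_ Suc.prems(2) Ua i \<open>i < m\<close> by simp
    qed (use W in simp)
    finally show ?thesis .
  qed
  then show ?case using unitary_mult[OF W(1) U] by blast
qed

section \<open>The spectral theorem for normal matrices\<close>

lemma csqrt_mult_cnj:
  assumes "0 \<le> z"
  shows "csqrt z * cnj (csqrt z) = z"
proof -
  obtain r where "z = complex_of_real r" "0 \<le> r"
    using assms by (cases z) (auto simp: less_eq_complex_def complex_eq_iff)
  then show ?thesis by (simp add: csqrt_of_real_nonneg flip: of_real_mult)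
qed

lemma eigenvector_exists:
  fixes A :: "complex mat"
  assumes "A \<in> carrier_mat n n" "n > 0"
  obtains v e where "v \<in> carrier_vec n" "v \<noteq> 0\<^sub>v n" "A *\<^sub>v v = e \<cdot>\<^sub>v v"
  using spectrum_non_empty[OF assms] assms
  by (auto simp: spectrum_def eigenvalue_def eigenvector_def)

text \<open>The (i, i) entries of B* B and B B* are the squared norms of column i and row i.
  Normality equates them, so once the column is reduced to its diagonal entry nothing is left for
  the rest of the row.\<close>

lemma normal_matrix_row_zero:
  fixes B :: "complex mat"
  assumes B: "B \<in> carrier_mat n n" and normal: "mat_adjoint B * B = B * mat_adjoint B"
    and i: "i < n" and col0: "\<And>l. l < n \<Longrightarrow> l \<noteq> i \<Longrightarrow> B $$ (l, i) = 0"
    and j: "j < n" "j \<noteq> i"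
  shows "B $$ (i, j) = 0"
proof -
  note adj = mat_adjoint_carrier[OF B]
  have "(\<Sum>l = 0..<n. (cmod (B $$ (i, l)))\<^sup>2) = (\<Sum>l = 0..<n. (cmod (B $$ (l, i)))\<^sup>2)"
  proof -
    have "complex_of_real (\<Sum>l = 0..<n. (cmod (B $$ (i, l)))\<^sup>2) = (B * mat_adjoint B) $$ (i, i)"
      using i by (simp add: mult_mat_index[OF B adj] mat_adjoint_index[OF B] complex_norm_square
          del: index_mult_mat of_real_power)
    also have "\<dots> = complex_of_real (\<Sum>l = 0..<n. (cmod (B $$ (l, i)))\<^sup>2)"
      unfolding normal[symmetric]
      using i by (simp add: mult_mat_index[OF adj B] mat_adjoint_index[OF B] complex_norm_square
          mult.commute del: index_mult_mat of_real_power)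
    finally show ?thesis by (simp only: of_real_eq_iff)
  qed
  also have "\<dots> = (cmod (B $$ (i, i)))\<^sup>2"
    using i col0 by (subst sum.remove[of _ i]) (auto intro!: sum.neutral)
  finally have "(\<Sum>l \<in> {0..<n} - {i}. (cmod (B $$ (i, l)))\<^sup>2) = 0"
    using i by (subst (asm) sum.remove[of _ i]) auto
  then show ?thesis using j by (subst (asm) sum_nonneg_eq_0_iff) auto
qed

text \<open>The first \<open>k\<close> columns of \<open>W\<close> are eigenvectors. In the basis given by \<open>W\<close>, normality makes the
  first \<open>k\<close> rows of \<open>A\<close> diagonal as well, so an eigenvector of the lower right block extends by
  zeros to an eigenvector orthogonal to the previous ones.\<close>

lemma normal_matrix_partial_eigenbasis:
  fixes A :: "complex mat"
  assumes A: "A \<in> carrier_mat n n" and normal: "mat_adjoint A * A = A * mat_adjoint A"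
    and "k \<le> n"
  shows "\<exists>W d. unitary n W \<and> (\<forall>i<k. A *\<^sub>v (W *\<^sub>v unit_vec n i) = d i \<cdot>\<^sub>v (W *\<^sub>v unit_vec n i))"
  using \<open>k \<le> n\<close>
proof (induction k)
  case 0
  then show ?case using unitary_one by blast
next
  case (Suc k)
  then obtain W d where W: "unitary n W"
    and ev: "\<And>i. i < k \<Longrightarrow> A *\<^sub>v (W *\<^sub>v unit_vec n i) = d i \<cdot>\<^sub>v (W *\<^sub>v unit_vec n i)"
    by auto
  note Wc = unitary_carrier[OF W]
  note Wa = mat_adjoint_carrier[OF Wc]
  define B where "B = mat_adjoint W * A * W"
  have B: "B \<in> carrier_mat n n" unfolding B_def by (rule mult_carrier_mat[OF mult_carrier_mat[OF Wa A] Wc])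
  have AW: "A *\<^sub>v (W *\<^sub>v v) = W *\<^sub>v (B *\<^sub>v v)" and BW: "B *\<^sub>v v = mat_adjoint W *\<^sub>v (A *\<^sub>v (W *\<^sub>v v))"
    if v: "v \<in> carrier_vec n" for v
  proof -
    have c: "W *\<^sub>v v \<in> carrier_vec n" "A *\<^sub>v (W *\<^sub>v v) \<in> carrier_vec n" using A Wc v by auto
    show 1: "B *\<^sub>v v = mat_adjoint W *\<^sub>v (A *\<^sub>v (W *\<^sub>v v))"
      unfolding B_def using assoc_mult_mat_vec[OF mult_carrier_mat[OF Wa A] Wc v]
        assoc_mult_mat_vec[OF Wa A c(1)] by simp
    show "A *\<^sub>v (W *\<^sub>v v) = W *\<^sub>v (B *\<^sub>v v)"
      unfolding 1 using unitary_mult_adjoint_vec[OF W c(2)] by simp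
  qed
  have adjB: "mat_adjoint B = mat_adjoint W * mat_adjoint A * W"
    unfolding B_def using Wc Wa A
    by (simp add: mat_adjoint_mult[of _ n n _ n] mat_adjoint_adjoint assoc_mult_mat[of _ n n _ n _ n])
  have normalB: "mat_adjoint B * B = B * mat_adjoint B"
  proof -
    \<comment> \<open>Conjugation by W is multiplicative, since W W* cancels in the middle;
      normality therefore passes from A to B.\<close>
    have prod: "(mat_adjoint W * X * W) * (mat_adjoint W * Y * W) = mat_adjoint W * (X * Y) * W"
      if X: "X \<in> carrier_mat n n" and Y: "Y \<in> carrier_mat n n" for X Y
    proof -
      have "(mat_adjoint W * X * W) * (mat_adjoint W * Y * W)
        = mat_adjoint W * X * (W * mat_adjoint W) * Y * W"
        using X Y Wc Wa by (simp add: assoc_mult_mat[of _ n n _ n _ n] mult_carrier_mat[of _ n n _ n])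
      also have "\<dots> = mat_adjoint W * X * Y * W"
        unfolding unitary_mult_adjoint[OF W] by (simp only: right_mult_one_mat[OF mult_carrier_mat[OF Wa X]])
      also have "\<dots> = mat_adjoint W * (X * Y) * W"
        by (simp add: assoc_mult_mat[OF Wa X Y])
      finally show ?thesis .
    qed
    show ?thesis unfolding adjB using normal prod A mat_adjoint_carrier[OF A] 
      by (simp add: B_def)
  qed
  have colB: "B $$ (l, i) = 0" if "i < k" "l < n" "l \<noteq> i" for i l
  proof -
    have i: "i < n" using that Suc.prems by simp
    have c: "W *\<^sub>v unit_vec n i \<in> carrier_vec n" using Wc by auto
    have "B *\<^sub>v unit_vec n i = d i \<cdot>\<^sub>v unit_vec n i"
      unfolding BW[OF unit_vec_carrier] ev[OF \<open>i < k\<close>] mult_mat_vec[OF Wa c]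
      by (simp add: unitary_adjoint_mult_vec[OF W])
    then have "col B i $ l = (d i \<cdot>\<^sub>v unit_vec n i) $ l"
      unfolding mult_mat_vec_unit_vec[OF B i] by simp
    then show ?thesis using that B i by simp
  qed
  have rowB: "B $$ (i, j) = 0" if "i < k" "j < n" "j \<noteq> i" for i j
    using normal_matrix_row_zero[OF B normalB, of i j] that colB Suc.prems by simp
  define C where "C = mat (n - k) (n - k) (\<lambda>(i, j). B $$ (i + k, j + k))"
  have C: "C \<in> carrier_mat (n - k) (n - k)" by (simp add: C_def)
  obtain v e where v: "v \<in> carrier_vec (n - k)" "v \<noteq> 0\<^sub>v (n - k)" and Cv: "C *\<^sub>v v = e \<cdot>\<^sub>v v"
    using eigenvector_exists[OF C] Suc.prems by auto
  define x where "x = vec n (\<lambda>i. if i < k then 0 else v $ (i - k))"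
  have x: "x \<in> carrier_vec n" by (simp add: x_def)
  have split: "(\<Sum>j = 0..<n. f j) = (\<Sum>j = 0..<k. f j) + (\<Sum>j = 0..<n - k. f (j + k))"
    for f :: "nat \<Rightarrow> complex"
    using sum.atLeastLessThan_concat[of 0 k n f] sum.shift_bounds_nat_ivl[of f 0 k "n - k"] Suc.prems
    by simp
  have Bx: "B *\<^sub>v x = e \<cdot>\<^sub>v x"
  proof (rule eq_vecI)
    fix i assume "i < dim_vec (e \<cdot>\<^sub>v x)"
    then have i: "i < n" using x by simp
    have s: "(B *\<^sub>v x) $ i = (\<Sum>j = 0..<n - k. B $$ (i, j + k) * v $ j)"
      unfolding mult_mat_vec_index[OF B x i] split using Suc.prems by (simp add: x_def)
    show "(B *\<^sub>v x) $ i = (e \<cdot>\<^sub>v x) $ i"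
    \<comment> \<open>In the first k rows B is diagonal, and there x vanishes; the remaining rows
      see only the block C, of which v is an eigenvector.\<close>
    proof (cases "i < k")
      case True
      then show ?thesis unfolding s using rowB i by (simp add: x_def)
    next
      case False
      then have ik: "i - k < n - k" using i by simp
      have "(\<Sum>j = 0..<n - k. B $$ (i, j + k) * v $ j) = (C *\<^sub>v v) $ (i - k)"
        unfolding mult_mat_vec_index[OF C v(1) ik] using False ik by (simp add: C_def)
      also have "\<dots> = e * v $ (i - k)" unfolding Cv using v ik by simp
      finally have "(\<Sum>j = 0..<n - k. B $$ (i, j + k) * v $ j) = e * v $ (i - k)" .
      then show ?thesis unfolding s using i False by (simp add: x_def)
    qed
  qed (use B x in auto)
  have "x \<noteq> 0\<^sub>v n"
  proof
    assume "x = 0\<^sub>v n"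
    then have "x $ (i + k) = 0" if "i < n - k" for i using that by simp
    then have "v = 0\<^sub>v (n - k)" using v by (intro eq_vecI) (auto simp: x_def)
    with v show False by simp
  qed
  \<comment> \<open>c is the length of x, so c e_k and x have equal length and some unitary H
    carries one to the other.\<close>
  define c where "c = csqrt (x \<bullet>c x)"
  have c0: "c \<noteq> 0" using \<open>x \<noteq> 0\<^sub>v n\<close> conjugate_square_eq_0_vec[OF x] by (simp add: c_def)
  have "c * cnj c = x \<bullet>c x"
    unfolding c_def by (rule csqrt_mult_cnj[OF conjugate_square_ge_0_vec])
  then have "(c \<cdot>\<^sub>v unit_vec n k) \<bullet>c (c \<cdot>\<^sub>v unit_vec n k) = x \<bullet>c x"
    using Suc.prems by (simp add: conjugate_smult_vec conjugate_unit_vec mult.commute)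
  from unitary_map_vec[OF smult_carrier_vec[THEN iffD2, OF unit_vec_carrier] x this]
  obtain H where H: "unitary n H" and Hk: "H *\<^sub>v (c \<cdot>\<^sub>v unit_vec n k) = x"
    and fix_: "\<And>w. w \<in> carrier_vec n \<Longrightarrow> w \<bullet>c (c \<cdot>\<^sub>v unit_vec n k) = w \<bullet>c x \<Longrightarrow> H *\<^sub>v w = w"
    by blast
  \<comment> \<open>For i < k the vector e_i is orthogonal to both e_k and x, hence fixed by
    H.\<close>
  have Hi: "H *\<^sub>v unit_vec n i = unit_vec n i" if i: "i < k" for i
  proof (rule fix_[OF unit_vec_carrier])
    have "unit_vec n i \<bullet>c x = 0" using i Suc.prems x by (simp add: x_def)
    moreover have "unit_vec n i \<bullet>c (c \<cdot>\<^sub>v unit_vec n k) = 0"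
      using i Suc.prems by (simp add: conjugate_smult_vec conjugate_unit_vec)
    ultimately show "unit_vec n i \<bullet>c (c \<cdot>\<^sub>v unit_vec n k) = unit_vec n i \<bullet>c x" by simp
  qed
  note Hc = unitary_carrier[OF H]
  have He: "c \<cdot>\<^sub>v (H *\<^sub>v unit_vec n k) = x"
    using Hk unfolding mult_mat_vec[OF Hc unit_vec_carrier] .
  have "H *\<^sub>v unit_vec n k = (1 / c) \<cdot>\<^sub>v (c \<cdot>\<^sub>v (H *\<^sub>v unit_vec n k))"
    using c0 by (simp add: smult_smult_assoc)
  also have "\<dots> = (1 / c) \<cdot>\<^sub>v x" by (simp only: He)
  finally have Hx: "H *\<^sub>v unit_vec n k = (1 / c) \<cdot>\<^sub>v x" .
  \<comment> \<open>Passing to W H keeps the eigenvectors already found and makes column k the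
    normalized eigenvector W x / c.\<close>
  let ?W = "W * H" and ?d = "d(k := e)"
  have "A *\<^sub>v (?W *\<^sub>v unit_vec n i) = ?d i \<cdot>\<^sub>v (?W *\<^sub>v unit_vec n i)" if "i < Suc k" for i
  proof (cases "i = k")
    case True
    have Wx: "W *\<^sub>v x \<in> carrier_vec n" using Wc x by auto
    have W1: "?W *\<^sub>v unit_vec n k = (1 / c) \<cdot>\<^sub>v (W *\<^sub>v x)"
      unfolding assoc_mult_mat_vec[OF Wc Hc unit_vec_carrier] Hx by (rule mult_mat_vec[OF Wc x])
    have "A *\<^sub>v (W *\<^sub>v x) = e \<cdot>\<^sub>v (W *\<^sub>v x)"
      unfolding AW[OF x] Bx by (rule mult_mat_vec[OF Wc x])
    then have "A *\<^sub>v (?W *\<^sub>v unit_vec n k) = e \<cdot>\<^sub>v (?W *\<^sub>v unit_vec n k)"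
      unfolding W1 mult_mat_vec[OF A Wx] by (simp add: smult_smult_assoc mult.commute)
    then show ?thesis using True by simp
  next
    case False
    then show ?thesis using that ev Hi by (simp add: assoc_mult_mat_vec[OF Wc Hc])
  qed
  then show ?case using unitary_mult[OF W H] by blast
qed

theorem spectral_theorem_normal:
  fixes A :: "complex mat"
  assumes A: "A \<in> carrier_mat n n" and normal: "mat_adjoint A * A = A * mat_adjoint A"
  obtains W d where "unitary n W" "\<And>i. i < n \<Longrightarrow> A *\<^sub>v col W i = d i \<cdot>\<^sub>v col W i"
proof -
  from normal_matrix_partial_eigenbasis[OF assms order_refl] obtain W d where W: "unitary n W"
    and ev: "\<forall>i<n. A *\<^sub>v (W *\<^sub>v unit_vec n i) = d i \<cdot>\<^sub>v (W *\<^sub>v unit_vec n i)" by blast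
  then show ?thesis using that mult_mat_vec_unit_vec[OF unitary_carrier[OF W]] by simp
qed

section \<open>Gram vectors and diagonalization of unitaries\<close>

text \<open>Polarization with the vectors \<open>e\<^sub>i + e\<^sub>j\<close> and \<open>e\<^sub>i + \<i> e\<^sub>j\<close>.\<close>

lemma psd_hermitian:
  assumes "psd d A"
  shows "mat_adjoint A = A"
proof -
  have A: "A \<in> carrier_mat d d" and nn: "\<And>v. v \<in> carrier_vec d \<Longrightarrow> 0 \<le> (A *\<^sub>v v) \<bullet>c v"
    using assms by (auto simp: psd_def)
  have form: "(A *\<^sub>v (unit_vec d i + z \<cdot>\<^sub>v unit_vec d j)) \<bullet>c (unit_vec d i + z \<cdot>\<^sub>v unit_vec d j)
    = A $$ (i, i) + z * A $$ (i, j) + cnj z * A $$ (j, i) + z * cnj z * A $$ (j, j)"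
    if "i < d" "j < d" for i j z
  proof -
    let ?e = "unit_vec d :: nat \<Rightarrow> complex vec"
    have "A *\<^sub>v (?e i + z \<cdot>\<^sub>v ?e j) = col A i + z \<cdot>\<^sub>v col A j"
      using that A by (simp add: mult_add_distrib_mat_vec[OF A] mult_mat_vec[OF A] mult_mat_vec_unit_vec[OF A])
    moreover have "conjugate (?e i + z \<cdot>\<^sub>v ?e j) = ?e i + cnj z \<cdot>\<^sub>v ?e j"
      by (subst conjugate_add_vec[of _ d]) (auto simp: conjugate_smult_vec conjugate_unit_vec)
    ultimately show ?thesis
      using that A 
      by (simp add: scalar_prod_add_distrib[of _ d] add_scalar_prod_distrib[of _ d] algebra_simps)
  qed
  have diag: "Im (A $$ (i, i)) = 0" if "i < d" for i
    using nn[of "unit_vec d i + 0 \<cdot>\<^sub>v unit_vec d i"] form[OF that that, of 0]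
    by (simp add: less_eq_complex_def)
  show ?thesis
  proof (rule eq_matI)
    fix i j assume "i < dim_row A" "j < dim_col A"
    then have ij: "i < d" "j < d" using A by auto
    \<comment> \<open>Values of the form are real. Taking z = 1 makes the imaginary parts of the two
      off-diagonal entries opposite, and z = \<i> makes their real parts equal.\<close>
    have "Im (A $$ (i, j) + A $$ (j, i)) = 0"
      using nn[of "unit_vec d i + 1 \<cdot>\<^sub>v unit_vec d j"] form[OF ij, of 1] diag ij
      by (simp add: less_eq_complex_def)
    moreover have "Re (A $$ (i, j)) = Re (A $$ (j, i))"
      using nn[of "unit_vec d i + \<i> \<cdot>\<^sub>v unit_vec d j"] form[OF ij, of \<i>] diag ij
      by (simp add: less_eq_complex_def)
    ultimately show "mat_adjoint A $$ (i, j) = A $$ (i, j)"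
      using mat_adjoint_index[OF A] ij by (simp add: complex_eq_iff)
  qed (use carrier_matD[OF A] carrier_matD[OF mat_adjoint_carrier[OF A]] in auto)
qed

text \<open>Diagonalize A as W D W* with D nonnegative; the vectors are the columns of D^(1/2) W*.
  The indices appear swapped in the inner product because it is conjugate-linear in its second
  argument.\<close>

lemma psd_imp_gram:
  assumes psd: "psd d A"
  obtains x where "\<And>i. x i \<in> carrier_vec d"
    "\<And>i j. i < d \<Longrightarrow> j < d \<Longrightarrow> A $$ (i, j) = x j \<bullet>c x i"
proof -
  have A: "A \<in> carrier_mat d d" using psd by (simp add: psd_def)
  have "mat_adjoint A * A = A * mat_adjoint A" using psd_hermitian[OF psd] by simp
  from spectral_theorem_normal[OF A this] obtain W e where W: "unitary d W"
    and ev: "\<And>i. i < d \<Longrightarrow> A *\<^sub>v col W i = e i \<cdot>\<^sub>v col W i" by blast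
  note Wc = unitary_carrier[OF W]
  note Wa = mat_adjoint_carrier[OF Wc]
  \<comment> \<open>An eigenvalue is the value of the form at a unit eigenvector.\<close>
  have e: "0 \<le> e l" if l: "l < d" for l
  proof -
    have c: "col W l \<in> carrier_vec d" using Wc l by auto
    have "0 \<le> (A *\<^sub>v col W l) \<bullet>c col W l" using psd c by (simp add: psd_def)
    also have "\<dots> = e l * (col W l \<bullet>c col W l)" using c by (simp add: ev[OF l])
    also have "\<dots> = e l" using W l by (simp add: unitary_iff_cscalar_prod_basis[OF Wc])
    finally show ?thesis .
  qed
  define x where "x j = vec d (\<lambda>l. csqrt (e l) * cnj (W $$ (j, l)))" for j
  have x: "x j \<in> carrier_vec d" for j by (simp add: x_def)
  have "A $$ (i, j) = x j \<bullet>c x i" if ij: "i < d" "j < d" for i j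
  proof -
    have "A $$ (i, j) = (A *\<^sub>v (W *\<^sub>v (mat_adjoint W *\<^sub>v unit_vec d j))) $ i"
      using ij A by (simp add: unitary_mult_adjoint_vec[OF W] mult_mat_vec_unit_vec[OF A])
    also have "\<dots> = ((A * W) *\<^sub>v col (mat_adjoint W) j) $ i"
      using ij A Wc Wa by (simp add: mult_mat_vec_unit_vec[OF Wa] assoc_mult_mat_vec[OF A Wc])
    also have "\<dots> = (\<Sum>l = 0..<d. (A * W) $$ (i, l) * cnj (W $$ (j, l)))"
      using ij Wa by (subst mult_mat_vec_index[OF mult_carrier_mat[OF A Wc]])
        (auto simp: mat_adjoint_index[OF Wc] carrier_matD[OF Wa] simp del: index_mult_mat intro!: sum.cong)
    also have "\<dots> = (\<Sum>l = 0..<d. x j $ l * cnj (x i $ l))"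
    proof (intro sum.cong refl)
      fix l assume "l \<in> {0..<d}"
      then have l: "l < d" by simp
      have "(A * W) $$ (i, l) = (A *\<^sub>v col W l) $ i" using A Wc ij l by simp
      also have "\<dots> = e l * W $$ (i, l)" unfolding ev[OF l] using Wc ij l by simp
      finally have "(A * W) $$ (i, l) = e l * W $$ (i, l)" .
      moreover have "e l = csqrt (e l) * cnj (csqrt (e l))"
        using csqrt_mult_cnj[OF e[OF l]] by simp
      ultimately show "(A * W) $$ (i, l) * cnj (W $$ (j, l)) = x j $ l * cnj (x i $ l)"
        using l by (simp add: x_def)
    qed
    also have "\<dots> = x j \<bullet>c x i" by (simp add: cscalar_prod_sum[OF x])
    finally show ?thesis .
  qed
  then show ?thesis using that x by blast
qed

text \<open>A unitary is normal, and being isometric forces its eigenvalues onto the circle. The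
  conclusion is phrased through coordinates in the eigenbasis, the form in which the block shift is
  iterated later.\<close>

lemma unitary_diagonalization:
  assumes U: "unitary n U"
  obtains W \<mu> where "unitary n W" "\<And>i. i < n \<Longrightarrow> cmod (\<mu> i) = 1"
    "\<And>v i. v \<in> carrier_vec n \<Longrightarrow> i < n \<Longrightarrow>
      (mat_adjoint W *\<^sub>v (U *\<^sub>v v)) $ i = \<mu> i * (mat_adjoint W *\<^sub>v v) $ i"
proof -
  note Uc = unitary_carrier[OF U]
  have "mat_adjoint U * U = U * mat_adjoint U"
    by (simp add: unitary_adjoint_mult[OF U] unitary_mult_adjoint[OF U])
  from spectral_theorem_normal[OF Uc this] obtain W \<mu> where W: "unitary n W"
    and ev: "\<And>i. i < n \<Longrightarrow> U *\<^sub>v col W i = \<mu> i \<cdot>\<^sub>v col W i" by blast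
  note Wc = unitary_carrier[OF W]
  have norm: "\<mu> i * cnj (\<mu> i) = 1" if i: "i < n" for i
  proof -
    have c: "col W i \<in> carrier_vec n" using Wc i by auto
    have one: "col W i \<bullet>c col W i = 1"
      using W i by (simp add: unitary_iff_cscalar_prod_basis[OF Wc])
    have "(U *\<^sub>v col W i) \<bullet>c (U *\<^sub>v col W i) = 1"
      using unitary_cscalar_prod[OF U c c] one by simp
    then show ?thesis using c one by (simp add: ev[OF i] conjugate_smult_vec mult.commute)
  qed
  have "(mat_adjoint W *\<^sub>v (U *\<^sub>v v)) $ i = \<mu> i * (mat_adjoint W *\<^sub>v v) $ i"
    if v: "v \<in> carrier_vec n" and i: "i < n" for v i
  proof -
    have c: "col W i \<in> carrier_vec n" using Wc i by auto
    have coord: "(mat_adjoint W *\<^sub>v w) $ i = w \<bullet>c col W i" if w: "w \<in> carrier_vec n" for w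
      unfolding mult_mat_vec_index[OF mat_adjoint_carrier[OF Wc] w i] cscalar_prod_sum[OF c]
      using i Wc by (intro sum.cong refl) (simp add: mat_adjoint_index[OF Wc] mult.commute)
    have Uv: "U *\<^sub>v v \<in> carrier_vec n" using Uc v by auto
    \<comment> \<open>Replace the multiple of the eigenvector by its image under U, then cancel U on
      both sides of the inner product.\<close>
    have "cnj (\<mu> i) * ((U *\<^sub>v v) \<bullet>c col W i) = (U *\<^sub>v v) \<bullet>c (\<mu> i \<cdot>\<^sub>v col W i)"
      using scalar_prod_smult_distrib[OF Uv carrier_vec_conjugate[OF c]]
      by (simp add: conjugate_smult_vec)
    also have "\<dots> = v \<bullet>c col W i"
      using unitary_cscalar_prod[OF U v c] by (simp add: ev[OF i])
    finally have "\<mu> i * (v \<bullet>c col W i) = \<mu> i * cnj (\<mu> i) * ((U *\<^sub>v v) \<bullet>c col W i)" by simp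
    then show ?thesis using coord[OF v] coord[of "U *\<^sub>v v"] Uc v norm[OF i] by simp
  qed
  moreover have "cmod (\<mu> i) = 1" if "i < n" for i
    using norm[OF that] by (metis complex_mod_sqrt_Re_mult_cnj one_complex.sel(1) real_sqrt_one)
  ultimately show ?thesis using that W by blast
qed

section \<open>Positivity of sums of product matrices\<close>

lemma quadratic_form_sum:
  fixes A :: "complex mat"
  assumes A: "A \<in> carrier_mat d d" and v: "v \<in> carrier_vec d"
  shows "(A *\<^sub>v v) \<bullet>c v = (\<Sum>a = 0..<d. \<Sum>b = 0..<d. A $$ (a, b) * v $ b * cnj (v $ a))"
  unfolding cscalar_prod_sum[OF v]
  by (intro sum.cong refl) (simp add: mult_mat_vec_index[OF A v] sum_distrib_right del: index_mult_mat_vec)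

lemma psd_msum:
  assumes fin: "finite I" and psd: "\<And>i. i \<in> I \<Longrightarrow> psd d (f i)"
  shows "psd d (msum d f I)"
proof -
  have c: "f i \<in> carrier_mat d d" if "i \<in> I" for i using psd[OF that] by (simp add: psd_def)
  have S: "msum d f I \<in> carrier_mat d d" by (rule msum_carrier[OF fin c])
  have "(msum d f I *\<^sub>v v) \<bullet>c v = (\<Sum>i\<in>I. (f i *\<^sub>v v) \<bullet>c v)" if v: "v \<in> carrier_vec d" for v
  proof -
    have "(msum d f I *\<^sub>v v) \<bullet>c v
      = (\<Sum>a = 0..<d. \<Sum>b = 0..<d. \<Sum>i\<in>I. f i $$ (a, b) * v $ b * cnj (v $ a))"
      unfolding quadratic_form_sum[OF S v]
      by (intro sum.cong refl) (simp add: msum_index[OF fin c] sum_distrib_right)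
    also have "\<dots> = (\<Sum>a = 0..<d. \<Sum>i\<in>I. \<Sum>b = 0..<d. f i $$ (a, b) * v $ b * cnj (v $ a))"
      by (intro sum.cong refl sum.swap)
    also have "\<dots> = (\<Sum>i\<in>I. \<Sum>a = 0..<d. \<Sum>b = 0..<d. f i $$ (a, b) * v $ b * cnj (v $ a))"
      by (rule sum.swap)
    also have "\<dots> = (\<Sum>i\<in>I. (f i *\<^sub>v v) \<bullet>c v)"
      by (intro sum.cong refl) (simp add: quadratic_form_sum[OF c v])
    finally show ?thesis .
  qed
  then show ?thesis using S psd by (auto simp: psd_def intro!: sum_nonneg)
qed

lemma psd_congruence:
  assumes B: "psd p B" and M: "M \<in> carrier_mat p m"
  shows "psd m (mat_adjoint M * B * M)"
proof -
  have Bc: "B \<in> carrier_mat p p" using B by (simp add: psd_def)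
  note Ma = mat_adjoint_carrier[OF M]
  have "((mat_adjoint M * B * M) *\<^sub>v v) \<bullet>c v = (B *\<^sub>v (M *\<^sub>v v)) \<bullet>c (M *\<^sub>v v)"
    if v: "v \<in> carrier_vec m" for v
  proof -
    have Mv: "M *\<^sub>v v \<in> carrier_vec p" "B *\<^sub>v (M *\<^sub>v v) \<in> carrier_vec p" using M Bc v by auto
    have "(mat_adjoint M * B * M) *\<^sub>v v = mat_adjoint M *\<^sub>v (B *\<^sub>v (M *\<^sub>v v))"
      using assoc_mult_mat_vec[OF mult_carrier_mat[OF Ma Bc] M v] assoc_mult_mat_vec[OF Ma Bc Mv(1)]
      by simp
    then show ?thesis
      using mat_adjoint_cscalar_prod[OF Ma Mv(2) v] by (simp add: mat_adjoint_adjoint)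
  qed
  moreover have "M *\<^sub>v v \<in> carrier_vec p" if "v \<in> carrier_vec m" for v using M that by auto
  moreover have "mat_adjoint M * B * M \<in> carrier_mat m m"
    by (rule mult_carrier_mat[OF mult_carrier_mat[OF Ma Bc] M])
  ultimately show ?thesis using B by (simp add: psd_def)
qed

text \<open>The quadratic form is the squared modulus of the sum of \<open>f b * v $ b\<close>. Both
  T_n(z) and the coefficients b_l have this shape.\<close>

lemma psd_rank_one: "psd d (mat d d (\<lambda>(a, b). cnj (f a) * f b))"
proof -
  let ?A = "mat d d (\<lambda>(a, b). cnj (f a) * f b)"
  have A: "?A \<in> carrier_mat d d" by simp
  have nonneg: "0 \<le> z * cnj z" for z by (simp add: less_eq_complex_def)
  have "0 \<le> (?A *\<^sub>v v) \<bullet>c v" if v: "v \<in> carrier_vec d" for v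
  proof -
    let ?s = "\<Sum>b = 0..<d. f b * v $ b"
    have "(?A *\<^sub>v v) \<bullet>c v = (\<Sum>a = 0..<d. \<Sum>b = 0..<d. (f b * v $ b) * cnj (f a * v $ a))"
      unfolding quadratic_form_sum[OF A v] by (intro sum.cong refl) simp
    also have "\<dots> = (\<Sum>b = 0..<d. \<Sum>a = 0..<d. (f b * v $ b) * cnj (f a * v $ a))"
      by (rule sum.swap)
    also have "\<dots> = ?s * cnj ?s" by (simp only: sum_product cnj_sum)
    also have "0 \<le> \<dots>" by (rule nonneg)
    finally show ?thesis .
  qed
  with A show ?thesis unfolding psd_def by blast
qed

text \<open>On the circle the inverse is the conjugate. The resulting factorization separates row
  from column index in T_n(z).\<close>

lemma powi_diff_unit_circle:
  assumes "cmod z = 1"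
  shows "z powi (int k - int j) = z ^ k * cnj (z ^ j)"
proof -
  have z0: "z \<noteq> 0" using assms by auto
  have "z * cnj z = 1" by (simp only: complex_norm_square[symmetric] assms) simp
  then have "z ^ j * cnj (z ^ j) = 1"
    by (simp only: complex_cnj_power power_mult_distrib[symmetric] power_one)
  then have "inverse (z ^ j) = cnj (z ^ j)" by (rule inverse_unique)
  moreover have "z powi (int k - int j) = z ^ k * inverse (z ^ j)"
    using z0 by (simp only: power_int_diff power_int_of_nat divide_inverse simp_thms)
  ultimately show ?thesis by (simp only:)
qed

lemma psd_toeplitz_pt:
  assumes "cmod z = 1"
  shows "psd n (toeplitz_pt n z)"
proof -
  have "toeplitz_pt n z = mat n n (\<lambda>(k, j). cnj (cnj (z ^ k)) * cnj (z ^ j))"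
    unfolding toeplitz_pt_def by (intro eq_matI) (simp_all add: powi_diff_unit_circle[OF assms])
  then show ?thesis using psd_rank_one[of n "\<lambda>j. cnj (z ^ j)"] by simp
qed

lemma psd_toeplitz_pt_kron:
  assumes z: "cmod z = 1" and B: "psd p B"
  shows "psd (n * p) (toeplitz_pt n z \<otimes>\<^sub>m B)"
proof -
  \<comment> \<open>M is the block row whose k-th block is cnj (z^k) times the identity of size p,
    so that M* B M has blocks z^k B cnj (z^j).\<close>
  define M where "M = mat p (n * p) (\<lambda>(a, j). if a = j mod p then cnj (z ^ (j div p)) else 0)"
  have M: "M \<in> carrier_mat p (n * p)" by (simp add: M_def)
  have Bc: "B \<in> carrier_mat p p" using B by (simp add: psd_def)
  have Tc: "toeplitz_pt n z \<in> carrier_mat n n" by (simp add: toeplitz_pt_def)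
  have Mi: "M $$ (a, j) = (if a = j mod p then cnj (z ^ (j div p)) else 0)"
    if "a < p" "j < n * p" for a j using that by (simp add: M_def)
  note Ma = mat_adjoint_carrier[OF M]
  note MB = mult_carrier_mat[OF Ma Bc]
  have "toeplitz_pt n z \<otimes>\<^sub>m B = mat_adjoint M * B * M"
  proof (rule eq_matI)
    fix i j assume "i < dim_row (mat_adjoint M * B * M)" "j < dim_col (mat_adjoint M * B * M)"
    then have ij: "i < n * p" "j < n * p" using carrier_matD[OF mult_carrier_mat[OF MB M]] by auto
    then have p: "i mod p < p" "j mod p < p" and d: "i div p < n" "j div p < n"
      by (auto simp: less_mult_imp_div_less intro!: mod_less_divisor gr0I)
    have inner: "(mat_adjoint M * B) $$ (i, b) = z ^ (i div p) * B $$ (i mod p, b)" if b: "b < p" for b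
    proof -
      have "(mat_adjoint M * B) $$ (i, b)
        = (\<Sum>a = 0..<p. if a = i mod p then z ^ (i div p) * B $$ (a, b) else 0)"
        unfolding mult_mat_index[OF Ma Bc ij(1) b]
        using ij by (intro sum.cong refl) (simp add: mat_adjoint_index[OF M] Mi)
      then show ?thesis using p by simp
    qed
    have "(mat_adjoint M * B * M) $$ (i, j)
      = (\<Sum>b = 0..<p. if b = j mod p then z ^ (i div p) * B $$ (i mod p, b) * cnj (z ^ (j div p)) else 0)"
      unfolding mult_mat_index[OF MB M ij] using ij
      by (intro sum.cong refl) (auto simp: inner Mi simp del: index_mult_mat)
    also have "\<dots> = z ^ (i div p) * B $$ (i mod p, j mod p) * cnj (z ^ (j div p))"
      using p by simp
    also have "\<dots> = (toeplitz_pt n z \<otimes>\<^sub>m B) $$ (i, j)"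
      unfolding kron_index[OF Tc Bc ij] using d by (simp add: toeplitz_pt_def powi_diff_unit_circle[OF z])
    finally show "(toeplitz_pt n z \<otimes>\<^sub>m B) $$ (i, j) = (mat_adjoint M * B * M) $$ (i, j)" by simp
  qed (use carrier_matD[OF kron_carrier[OF Tc Bc]] carrier_matD[OF mult_carrier_mat[OF MB M]] in auto)
  then show ?thesis using psd_congruence[OF B M] by simp
qed

section \<open>Decomposition of positive block Toeplitz matrices\<close>

text \<open>The block Toeplitz structure says that shifting by one block preserves the Gram matrix of the
  vectors representing \<open>T\<close>, so the shift is implemented by a unitary. In its eigenbasis, the
  vectors of the \<open>k\<close>-th block arise from those of the first one by \<open>k\<close>-th powers of the eigenvalues.\<close>

lemma psd_block_toeplitz_shift_diagonal:
  assumes psd: "psd (n * p) (block_toeplitz n p \<tau>)"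
  obtains \<mu> x where "\<And>l. l < n * p \<Longrightarrow> cmod (\<mu> l) = 1"
    "\<And>i j. i < n * p \<Longrightarrow> j < n * p \<Longrightarrow>
      block_toeplitz n p \<tau> $$ (i, j) = (\<Sum>l = 0..<n * p. cnj (x i l) * x j l)"
    "\<And>i l. l < n * p \<Longrightarrow> i + p < n * p \<Longrightarrow> x (i + p) l = \<mu> l * x i l"
proof -
  let ?T = "block_toeplitz n p \<tau>"
  let ?N = "n * p"
  obtain y where y: "\<And>i. y i \<in> carrier_vec ?N"
    and T: "\<And>i j. i < ?N \<Longrightarrow> j < ?N \<Longrightarrow> ?T $$ (i, j) = y j \<bullet>c y i"
    using psd_imp_gram[OF psd] by blast
  have shift: "?T $$ (i + p, j + p) = ?T $$ (i, j)" if "i + p < ?N" "j + p < ?N" for i j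
  proof -
    have "p > 0" using that by (intro gr0I) auto
    then show ?thesis using that by (simp add: block_toeplitz_def)
  qed
  \<comment> \<open>The first and last \<open>n * p - p\<close> vectors have the same Gram matrix;
    the translation by p is one block step.\<close>
  have "y i \<bullet>c y j = y (i + p) \<bullet>c y (j + p)" if "i < ?N - p" "j < ?N - p" for i j
    using that shift[of j i] T[of j i] T[of "j + p" "i + p"] by simp
  from unitary_extension[of "?N - p" y ?N "\<lambda>i. y (i + p)", OF y y this]
  obtain U where U: "unitary ?N U" and Uy: "\<And>i. i < ?N - p \<Longrightarrow> U *\<^sub>v y i = y (i + p)" by blast
  from unitary_diagonalization[OF U] obtain W \<mu> where W: "unitary ?N W"
    and \<mu>: "\<And>i. i < ?N \<Longrightarrow> cmod (\<mu> i) = 1"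
    and WU: "\<And>v i. v \<in> carrier_vec ?N \<Longrightarrow> i < ?N \<Longrightarrow>
      (mat_adjoint W *\<^sub>v (U *\<^sub>v v)) $ i = \<mu> i * (mat_adjoint W *\<^sub>v v) $ i" by blast
  note Wc = unitary_carrier[OF W]
  note Wa = mat_adjoint_carrier[OF Wc]
  define x where "x i l = (mat_adjoint W *\<^sub>v y i) $ l" for i l
  have "?T $$ (i, j) = (\<Sum>l = 0..<?N. cnj (x i l) * x j l)" if "i < ?N" "j < ?N" for i j
  proof -
    have "?T $$ (i, j) = y j \<bullet>c (W *\<^sub>v (mat_adjoint W *\<^sub>v y i))"
      using T[OF that] unitary_mult_adjoint_vec[OF W y] by simp
    also have "\<dots> = (mat_adjoint W *\<^sub>v y j) \<bullet>c (mat_adjoint W *\<^sub>v y i)"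
      using mat_adjoint_cscalar_prod[OF Wa y mult_mat_vec_carrier[OF Wa y]]
      by (simp add: mat_adjoint_adjoint)
    finally show ?thesis
      unfolding cscalar_prod_sum[OF mult_mat_vec_carrier[OF Wa y]] x_def by (simp add: mult.commute)
  qed
  moreover have "x (i + p) l = \<mu> l * x i l" if "l < ?N" "i + p < ?N" for i l
    unfolding x_def using WU[OF y[of i] that(1)] Uy[of i] that(2) by simp
  ultimately show ?thesis using that \<mu> by blast
qed

theorem psd_block_toeplitz_decomposition:
  assumes psd: "psd (n * p) (block_toeplitz n p \<tau>)"
  obtains z b where "\<And>l. l < n * p \<Longrightarrow> cmod (z l) = 1" "\<And>l. psd p (b l)"
    "block_toeplitz n p \<tau> = msum (n * p) (\<lambda>l. toeplitz_pt n (z l) \<otimes>\<^sub>m b l) {..<n * p}"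
proof -
  let ?T = "block_toeplitz n p \<tau>"
  let ?N = "n * p"
  from psd_block_toeplitz_shift_diagonal[OF psd] obtain \<mu> x
    where \<mu>: "\<And>l. l < ?N \<Longrightarrow> cmod (\<mu> l) = 1"
      and T: "\<And>i j. i < ?N \<Longrightarrow> j < ?N \<Longrightarrow> ?T $$ (i, j) = (\<Sum>l = 0..<?N. cnj (x i l) * x j l)"
      and shift: "\<And>i l. l < ?N \<Longrightarrow> i + p < ?N \<Longrightarrow> x (i + p) l = \<mu> l * x i l" by blast
  have power: "x (k * p + a) l = \<mu> l ^ k * x a l" if "l < ?N" "k * p + a < ?N" for k a l
    using that(2)
  proof (induction k)
    case (Suc k)
    then show ?case using shift[OF that(1), of "k * p + a"] by (simp add: add_ac)
  qed simp
  \<comment> \<open>Row indices carry the conjugated coordinates, so block (k, j) picks up cnj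
    (\<mu>_l)^k \<mu>_l^j, which is z_l^(k-j) for the conjugate z_l. Only the vectors of block 0
    remain, and they define \<open>b l\<close>.\<close>
  define z where "z l = cnj (\<mu> l)" for l
  define b where "b l = mat p p (\<lambda>(i, j). cnj (x i l) * x j l)" for l
  have b: "psd p (b l)" for l unfolding b_def by (rule psd_rank_one)
  have bc: "b l \<in> carrier_mat p p" for l by (simp add: b_def)
  have tc: "toeplitz_pt n (z l) \<in> carrier_mat n n" for l by (simp add: toeplitz_pt_def)
  note c = kron_carrier[OF tc bc]
  have z: "cmod (z l) = 1" if "l < ?N" for l using \<mu>[OF that] by (simp add: z_def)
  let ?S = "msum ?N (\<lambda>l. toeplitz_pt n (z l) \<otimes>\<^sub>m b l) {..<?N}"
  note S = msum_carrier[OF finite_lessThan c]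
  have "?T = ?S"
  proof (rule eq_matI)
    fix i j assume "i < dim_row ?S" "j < dim_col ?S"
    then have ij: "i < ?N" "j < ?N" using carrier_matD[OF S] by auto
    then have p: "i mod p < p" "j mod p < p" and d: "i div p < n" "j div p < n"
      by (auto simp: less_mult_imp_div_less intro!: mod_less_divisor gr0I)
    have "?S $$ (i, j) = (\<Sum>l<?N. (toeplitz_pt n (z l) \<otimes>\<^sub>m b l) $$ (i, j))"
      by (rule msum_index[OF finite_lessThan c ij])
    also have "\<dots> = (\<Sum>l<?N. cnj (x i l) * x j l)"
    proof (intro sum.cong refl)
      fix l assume "l \<in> {..<?N}"
      then have l: "l < ?N" by simp
      have "(toeplitz_pt n (z l) \<otimes>\<^sub>m b l) $$ (i, j)
        = z l ^ (i div p) * cnj (z l ^ (j div p)) * (cnj (x (i mod p) l) * x (j mod p) l)"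
        unfolding kron_index[OF tc bc ij] using d p
        by (simp add: toeplitz_pt_def b_def powi_diff_unit_circle[OF z[OF l]])
      then show "(toeplitz_pt n (z l) \<otimes>\<^sub>m b l) $$ (i, j) = cnj (x i l) * x j l"
        using power[OF l, of "i div p" "i mod p"] power[OF l, of "j div p" "j mod p"] ij
        by (simp add: z_def)
    qed
    finally show "?T $$ (i, j) = ?S $$ (i, j)" using T[OF ij] by (simp add: lessThan_atLeast0)
  qed (use carrier_matD[OF S] in \<open>auto simp: block_toeplitz_def\<close>)
  then show ?thesis using that z b by blast
qed

theorem corollary3p3:
  fixes n p :: nat
  assumes "n \<ge> 1" and "p \<ge> 1"
  shows "(\<forall>x \<in> pos_cone (n * p) (min_tensor n p (toeplitz_system n) (carrier_mat p p)).
            separable n p (toeplitz_system n) (carrier_mat p p) x) \<and>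
         (\<forall>T \<in> min_tensor n p (toeplitz_system n) (carrier_mat p p).
            T \<in> pos_cone (n * p) (min_tensor n p (toeplitz_system n) (carrier_mat p p)) \<longleftrightarrow>
            (\<exists>(m::nat) (z::nat \<Rightarrow> complex) (b::nat \<Rightarrow> complex mat).
               (\<forall>j<m. cmod (z j) = 1 \<and> b j \<in> pos_cone p (carrier_mat p p)) \<and>
               T = msum (n * p) (\<lambda>j. toeplitz_pt n (z j) \<otimes>\<^sub>m b j) {..<m}))"
    (is "(\<forall>x \<in> pos_cone _ ?M. _) \<and> (\<forall>T \<in> ?M. _ \<longleftrightarrow> ?D T)")
proof -
  have decomp: "?D T" if "T \<in> pos_cone (n * p) ?M" for T
  proof -
    from that obtain \<tau> where T: "T = block_toeplitz n p \<tau>" and psd: "psd (n * p) T"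
      by (auto simp: pos_cone_def min_tensor_toeplitz_iff_block)
    from psd_block_toeplitz_decomposition[OF psd[unfolded T]] obtain z b
      where z: "\<And>l. l < n * p \<Longrightarrow> cmod (z l) = 1" and b: "\<And>l. psd p (b l)"
        and S: "T = msum (n * p) (\<lambda>l. toeplitz_pt n (z l) \<otimes>\<^sub>m b l) {..<n * p}"
      unfolding T by blast
    have "b l \<in> pos_cone p (carrier_mat p p)" for l
      using b[of l] by (simp add: pos_cone_def psd_def)
    with z S show ?thesis by (intro exI[of _ "n * p"] exI[of _ z] exI[of _ b]) simp
  qed
  \<comment> \<open>Each T_n(z_j) is itself a positive Toeplitz matrix, so the decomposition over
    circle points is already a separable one.\<close>
  have "separable n p (toeplitz_system n) (carrier_mat p p) T" if D: "?D T" for T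
  proof -
    have "toeplitz_pt n z \<in> toeplitz_system n" for z
      unfolding toeplitz_system_def toeplitz_pt_def by (intro CollectI exI[of _ "\<lambda>l. z powi l"]) simp
    then have "toeplitz_pt n z \<in> pos_cone n (toeplitz_system n)" if "cmod z = 1" for z
      using psd_toeplitz_pt[OF that] by (simp add: pos_cone_def)
    moreover from D obtain m :: nat and z b
      where "\<forall>j<m. cmod (z j) = 1 \<and> b j \<in> pos_cone p (carrier_mat p p)"
        and "T = msum (n * p) (\<lambda>j. toeplitz_pt n (z j) \<otimes>\<^sub>m b j) {..<m}" by blast
    ultimately show ?thesis
      unfolding separable_def by (intro exI[of _ m] exI[of _ "\<lambda>j. toeplitz_pt n (z j)"] exI[of _ b]) auto
  qed
  moreover have "T \<in> pos_cone (n * p) ?M" if "T \<in> ?M" "?D T" for T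
  proof -
    from that(2) obtain m :: nat and z b
      where zb: "\<And>j. j < m \<Longrightarrow> cmod (z j) = 1 \<and> b j \<in> pos_cone p (carrier_mat p p)"
        and T: "T = msum (n * p) (\<lambda>j. toeplitz_pt n (z j) \<otimes>\<^sub>m b j) {..<m}" by blast
    have "psd (n * p) T"
      unfolding T using zb by (intro psd_msum psd_toeplitz_pt_kron) (auto simp: pos_cone_def)
    then show ?thesis using that(1) by (simp add: pos_cone_def)
  qed
  ultimately show ?thesis using decomp by blast
qed

end
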